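(* Let $\mathcal{X}\subset\mathbb{R}^d$, let $f_0:\mathcal{X}\to\mathbb{R}$ attain its maximum $f^*=\max_{x\in\mathcal{X}}f_0(x)$, let $0\le\rho<1$, and let $f:\mathcal{X}\to\mathbb{R}$ be a $\rho$-gap-adjusted misspecified approximation of $f_0$. Then: 1. (Preservation of maximizers) $\operatorname{argmax}_{x\in\mathcal{X}}f(x)=\operatorname{argmax}_{x\in\mathcal{X}}f_0(x)$. 2. (Preservation of max value) $\max_{x\in\mathcal{X}}f(x)=f^*$. 3. (Self-bounding property) For all $x\in\mathcal{X}$, $|f(x)-f_0(x)|\le\rho\,(f^*-f_0(x))=\rho\, r(x)$, where $r(x):=f^*-f_0(x)$.
   Context: For $0\le\rho<1$, $f$ is a $\rho$-gap-adjusted misspecified ($\rho$-GAM) approximation of $f_0$ if $\sup_{x\in\mathcal{X}}\left|\frac{f(x)-f_0(x)}{f^*-f_0(x)}\right|\le\rho$, understood (including at points where the denominator vanishes) as: $|f(x)-f_0(x)|\le\rho\,|f^*-f_0(x)|$ for all $x\in\mathcal{X}$. Here $\operatorname{argmax}$ denotes the set of all global maximizers. *)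

theory Defs
  imports "HOL-Analysis.Analysis"
begin

text \<open>A function on a set \<open>X\<close> is represented by a total function of which only the
  values on \<open>X\<close> are used.\<close>

definition argmax_set :: "('a \<Rightarrow> real) \<Rightarrow> 'a set \<Rightarrow> 'a set" where
  "argmax_set f X = {x. is_arg_max f (\<lambda>x. x \<in> X) x}"

text \<open>\<open>has_max_on f X m\<close>: the maximum of \<open>f\<close> over \<open>X\<close> exists (is attained) and equals \<open>m\<close>.\<close>

definition has_max_on :: "('a \<Rightarrow> real) \<Rightarrow> 'a set \<Rightarrow> real \<Rightarrow> bool" where
  "has_max_on f X m \<longleftrightarrow> (\<exists>x\<in>X. f x = m) \<and> (\<forall>x\<in>X. f x \<le> m)"

text \<open>\<open>gap_adjusted_misspecified \<rho> X fstar f0 f\<close>: \<open>f\<close> is a \<open>\<rho>\<close>-GAM approximation of \<open>f0\<close> on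
  \<open>X\<close>, where \<open>fstar\<close> is meant to be the maximum of \<open>f0\<close> over \<open>X\<close>. The ratio bound is in its
  product form, which forces \<open>f x = f0 x\<close> wherever the gap \<open>fstar - f0 x\<close> vanishes.\<close>

definition gap_adjusted_misspecified ::
  "real \<Rightarrow> 'a set \<Rightarrow> real \<Rightarrow> ('a \<Rightarrow> real) \<Rightarrow> ('a \<Rightarrow> real) \<Rightarrow> bool" where
  "gap_adjusted_misspecified \<rho> X fstar f0 f \<longleftrightarrow>
     (\<forall>x\<in>X. \<bar>f x - f0 x\<bar> \<le> \<rho> * \<bar>fstar - f0 x\<bar>)"

definition regret :: "real \<Rightarrow> ('a \<Rightarrow> real) \<Rightarrow> 'a \<Rightarrow> real" where
  "regret fstar f0 x = fstar - f0 x"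

end

theory Submission
  imports Defs
begin

text \<open>The gap \<open>fstar - f x\<close> lies between \<open>(1 - \<rho>)\<close> and \<open>(1 + \<rho>)\<close> times the gap
  \<open>fstar - f0 x\<close>. As \<open>1 - \<rho> > 0\<close>, the two gaps are nonnegative together and vanish at the
  same points.\<close>

text \<open>Reduces equality of two argmax sets with a common maximum value to a pointwise
  equivalence.\<close>

lemma argmax_set_eq_level_set:
  assumes "has_max_on f X m"
  shows "argmax_set f X = {x \<in> X. f x = m}"
  using assms unfolding argmax_set_def has_max_on_def is_arg_max_linorder
  by (auto intro: antisym)

lemma gap_adjusted_misspecified_self_bounding:
  assumes "has_max_on f0 X fstar" "gap_adjusted_misspecified \<rho> X fstar f0 f" "x \<in> X"
  shows "\<bar>f x - f0 x\<bar> \<le> \<rho> * (fstar - f0 x)"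
  using assms unfolding has_max_on_def gap_adjusted_misspecified_def by force

lemma gap_adjusted_misspecified_le_and_eq_iff:
  assumes "has_max_on f0 X fstar" "\<rho> < 1" "gap_adjusted_misspecified \<rho> X fstar f0 f" "x \<in> X"
  shows "f x \<le> fstar" and "f x = fstar \<longleftrightarrow> f0 x = fstar"
proof -
  have bound: "\<bar>f x - f0 x\<bar> \<le> \<rho> * (fstar - f0 x)"
    using assms by (intro gap_adjusted_misspecified_self_bounding)
  have gap: "0 \<le> fstar - f0 x"
    using assms(1,4) by (simp add: has_max_on_def)
  \<comment> \<open>Only the upper half of \<open>bound\<close> enters: subtract it from the gap
    \<open>fstar - f0 x\<close>.\<close>
  have lower: "(1 - \<rho>) * (fstar - f0 x) \<le> fstar - f x"
    using bound by (simp add: algebra_simps)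
  have "0 \<le> (1 - \<rho>) * (fstar - f0 x)"
    using gap assms(2) by simp
  with lower show "f x \<le> fstar" by linarith
  show "f x = fstar \<longleftrightarrow> f0 x = fstar"
  proof
    assume "f x = fstar"
    with lower have "(1 - \<rho>) * (fstar - f0 x) \<le> 0" by simp
    with assms(2) gap show "f0 x = fstar" by (simp add: mult_le_0_iff)
  next
    \<comment> \<open>At zero gap the right side of \<open>bound\<close> is 0.\<close>
    assume "f0 x = fstar"
    with bound show "f x = fstar" by simp
  qed
qed

theorem proposition3:
  fixes X :: "(real ^ 'd) set"
    and f0 f :: "real ^ 'd \<Rightarrow> real"
    and fstar \<rho> :: real
  assumes "has_max_on f0 X fstar"
    and "0 \<le> \<rho>" and "\<rho> < 1"
    and "gap_adjusted_misspecified \<rho> X fstar f0 f"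
  shows "argmax_set f X = argmax_set f0 X
    \<and> has_max_on f X fstar
    \<and> (\<forall>x\<in>X. \<bar>f x - f0 x\<bar> \<le> \<rho> * (fstar - f0 x)
              \<and> \<rho> * (fstar - f0 x) = \<rho> * regret fstar f0 x)"
proof -
  note gap = gap_adjusted_misspecified_le_and_eq_iff[OF assms(1,3,4)]
  \<comment> \<open>A maximizer of \<open>f0\<close> is the witness: \<open>f\<close> also takes the
    value \<open>fstar\<close> there, by \<open>gap(2)\<close>.\<close>
  have max: "has_max_on f X fstar"
    using assms(1) gap unfolding has_max_on_def by blast
  have "argmax_set f X = argmax_set f0 X"
    using gap(2) by (auto simp: argmax_set_eq_level_set[OF max] argmax_set_eq_level_set[OF assms(1)])
  with max show ?thesis
    using gap_adjusted_misspecified_self_bounding[OF assms(1,4)] by (simp add: regret_def)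
qed

end
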